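(* Let $f(X)=\sum_{i=0}^n a_iX^i\in A[X;\sigma,\delta]$ be monic of degree $n$, and let $\mathcal{C}\subseteq A^n$ be the principal $(f,\sigma,\delta)$-code generated by a monic $g(X)=\sum_{i=0}^r g_iX^i\in A[X;\sigma,\delta]$ of degree $r$ (so $g$ is a right divisor of $f$). Then a generating matrix $G\in M_{n-r,n}(A)$ of $\mathcal{C}$ is $$G=\left( \begin{array}{ccccccc} g_0 & \dots & g_r & 0& 0 & \dots & 0\\ g_0^{(1)} & \dots & g_r^{(1)} & \sigma(g_r) & 0 &\dots & 0\\ g_0^{(2)} & \dots & g_r^{(2)} & g_{r+1}^{(2)} & \sigma^2(g_r) &\dots & 0\\ \vdots & \vdots & \vdots & \vdots &\vdots& \vdots & \vdots \\ g_0^{(n-r-1)} & \dots & g_r^{(n-r-1)} & g_{r+1}^{(n-r-1)} & g_{r+2}^{(n-r-1)} &\dots & \sigma^{n-r-1}(g_r) \end{array} \right),$$ that is, numbering rows by $0\le i\le n-r-1$ and columns by $0\le j\le n-1$, the $(i,j)$ entry is $g_j^{(i)}$ for $j<r+i$, is $\sigma^i(g_r)$ for $j=r+i$, and is $0$ for $j>r+i$. Here (1) $g_i=0$ for $r+1\le i\le n-1$; (2) $g_0^{(i)}=\delta(g_0^{(i-1)})$ for $1\le i\le n-r-1$; (3) $g_j^{(i)}=\delta(g_j^{(i-1)})+\sigma(g_{j-1}^{(i-1)})$ for $1\le i\le n-r-1$ and $1\le j\le n-2$.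
   Context: $A$ is a ring with identity (not necessarily commutative), assumed to have invariant basis number so that ranks of finitely generated free modules are well defined; $\sigma:A\to A$ is a ring endomorphism with $\sigma(1)=1$; $\delta$ is a $\sigma$-derivation of $A$, i.e. $\delta$ is additive and $\delta(ab)=\sigma(a)\delta(b)+\delta(a)b$. $A[X;\sigma,\delta]$ is the skew-polynomial ring of elements $\sum a_iX^i$ with multiplication determined by $Xa=\sigma(a)X+\delta(a)$; $(p)_l$ denotes the left ideal generated by $p$. For a monic $f=\sum_{i=0}^n a_iX^i$ with companion matrix $C_f$ (ones on the superdiagonal, last row $(-a_0,\dots,-a_{n-1})$, zeros elsewhere), let $T_f:A^n\to A^n$, $T_f(x_0,\dots,x_{n-1})=(\sigma(x_0),\dots,\sigma(x_{n-1}))C_f+(\delta(x_0),\dots,\delta(x_{n-1}))$. For $x=(x_0,\dots,x_{n-1})\in A^n$ and $k\ge 0$ write $(x_0^{(k)},\dots,x_{n-1}^{(k)})=T_f^k(x_0,\dots,x_{n-1})$, so $x_i^{(0)}=x_i$; in particular $(g_0^{(k)},\dots,g_{n-1}^{(k)})=T_f^k(g_0,\dots,g_r,0,\dots,0)$. Let $\phi_f:A^n\to A[X;\sigma,\delta]/(f)_l$, $(d_0,\dots,d_{n-1})\mapsto\sum_{i=0}^{n-1}d_iX^i+(f)_l$ (a bijection). An $(f,\sigma,\delta)$-code is a subset $\phi_f^{-1}(\mathcal{M})$ of $A^n$ with $\mathcal{M}$ a left $A[X;\sigma,\delta]$-submodule of $A[X;\sigma,\delta]/(f)_l$. It is principal,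 generated by $g$, if $g$ is a right divisor of $f$ and $\mathcal{M}=(g)_l/(f)_l$. A generating matrix of an $A$-free code $\mathcal{C}$ of rank $m$ is a matrix in $M_{m,n}(A)$ whose rows form a basis of $\mathcal{C}$ as a left $A$-module. *)

theory Defs
  imports "HOL-Computational_Algebra.Polynomial" "HOL-Algebra.Ideal" "Jordan_Normal_Form.Matrix"
begin

section \<open>Ring endomorphisms, skew derivations, invariant basis number\<close>

definition ring_endo :: "('a::ring_1 \<Rightarrow> 'a) \<Rightarrow> bool" where
  "ring_endo \<sigma> \<longleftrightarrow> (\<forall>a b. \<sigma> (a + b) = \<sigma> a + \<sigma> b) \<and> (\<forall>a b. \<sigma> (a * b) = \<sigma> a * \<sigma> b) \<and> \<sigma> 1 = 1"

definition skew_derivation :: "('a::ring_1 \<Rightarrow> 'a) \<Rightarrow> ('a \<Rightarrow> 'a) \<Rightarrow> bool" where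
  "skew_derivation \<sigma> \<delta> \<longleftrightarrow> (\<forall>a b. \<delta> (a + b) = \<delta> a + \<delta> b) \<and> (\<forall>a b. \<delta> (a * b) = \<sigma> a * \<delta> b + \<delta> a * b)"

text \<open>The left module $A^n$ is \<^term>\<open>carrier_vec n :: 'a vec set\<close>; scalars act from the left by
  \<^term>\<open>a \<cdot>\<^sub>v v\<close>.\<close>

definition left_linear :: "nat \<Rightarrow> ('a::ring_1 vec \<Rightarrow> 'a vec) \<Rightarrow> bool" where
  "left_linear m h \<longleftrightarrow>
     (\<forall>x\<in>carrier_vec m. \<forall>y\<in>carrier_vec m. h (x + y) = h x + h y) \<and>
     (\<forall>a. \<forall>x\<in>carrier_vec m. h (a \<cdot>\<^sub>v x) = a \<cdot>\<^sub>v h x)"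

definition invariant_basis_number :: "'a::ring_1 itself \<Rightarrow> bool" where
  "invariant_basis_number _ \<longleftrightarrow>
     (\<forall>m n. (\<exists>h :: 'a vec \<Rightarrow> 'a vec. left_linear m h \<and> bij_betw h (carrier_vec m) (carrier_vec n))
        \<longrightarrow> m = n)"

section \<open>The skew polynomial ring\<close>

text \<open>Skew polynomials $\sum a_i X^i$ (coefficients on the left) are represented by the type
  \<^typ>\<open>'a poly\<close>, of which only the additive structure is used; the library multiplication exists
  only for commutative coefficients and is not involved. The relation
  $X a = \sigma(a) X + \delta(a)$ gives
  $X \cdot \sum a_i X^i = \sum \sigma(a_i) X^{i+1} + \sum \delta(a_i) X^i$, and the product is
  $(\sum a_i X^i) q = \sum a_i (X^i q)$.\<close>

definition skew_X :: "('a::ring_1 \<Rightarrow> 'a) \<Rightarrow> ('a \<Rightarrow> 'a) \<Rightarrow> 'a poly \<Rightarrow> 'a poly" where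
  "skew_X \<sigma> \<delta> q = pCons 0 (map_poly \<sigma> q) + map_poly \<delta> q"

definition skew_mult :: "('a::ring_1 \<Rightarrow> 'a) \<Rightarrow> ('a \<Rightarrow> 'a) \<Rightarrow> 'a poly \<Rightarrow> 'a poly \<Rightarrow> 'a poly" where
  "skew_mult \<sigma> \<delta> p q = (\<Sum>i\<le>degree p. map_poly ((*) (coeff p i)) ((skew_X \<sigma> \<delta> ^^ i) q))"

definition skew_poly_ring :: "('a::ring_1 \<Rightarrow> 'a) \<Rightarrow> ('a \<Rightarrow> 'a) \<Rightarrow> 'a poly ring" where
  "skew_poly_ring \<sigma> \<delta> =
     \<lparr>carrier = UNIV, monoid.mult = skew_mult \<sigma> \<delta>, one = [:1:], zero = 0, add = (+)\<rparr>"

lemma skew_poly_ring_simps [simp]: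
  "carrier (skew_poly_ring \<sigma> \<delta>) = UNIV"
  "x \<otimes>\<^bsub>skew_poly_ring \<sigma> \<delta>\<^esub> y = skew_mult \<sigma> \<delta> x y"
  "\<one>\<^bsub>skew_poly_ring \<sigma> \<delta>\<^esub> = [:1:]"
  "\<zero>\<^bsub>skew_poly_ring \<sigma> \<delta>\<^esub> = 0"
  "x \<oplus>\<^bsub>skew_poly_ring \<sigma> \<delta>\<^esub> y = x + y"
  by (simp_all add: skew_poly_ring_def)

context
  fixes \<sigma> \<delta> :: "'a::ring_1 \<Rightarrow> 'a"
  assumes endo: "ring_endo \<sigma>" and deriv: "skew_derivation \<sigma> \<delta>"
begin

private lemma s_add: "\<sigma> (a + b) = \<sigma> a + \<sigma> b" and s_mult: "\<sigma> (a * b) = \<sigma> a * \<sigma> b" and s_1: "\<sigma> 1 = 1"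
  using endo by (auto simp: ring_endo_def)

private lemma d_add: "\<delta> (a + b) = \<delta> a + \<delta> b" and d_mult: "\<delta> (a * b) = \<sigma> a * \<delta> b + \<delta> a * b"
  using deriv by (auto simp: skew_derivation_def)

private lemma s_0: "\<sigma> 0 = 0" using s_add[of 0 0] by simp
private lemma d_0: "\<delta> 0 = 0" using d_add[of 0 0] by simp
private lemma d_1: "\<delta> 1 = 0" using d_mult[of 1 1] s_1 by simp

private abbreviation L :: "'a \<Rightarrow> 'a poly \<Rightarrow> 'a poly" where "L a \<equiv> map_poly ((*) a)"
private abbreviation Xm :: "'a poly \<Rightarrow> 'a poly" where "Xm \<equiv> skew_X \<sigma> \<delta>"
private abbreviation M :: "'a poly \<Rightarrow> 'a poly \<Rightarrow> 'a poly" where "M \<equiv> skew_mult \<sigma> \<delta>"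

private lemma cL: "coeff (L a q) n = a * coeff q n"
  by (simp add: coeff_map_poly)

private lemma cX: "coeff (Xm q) n = (case n of 0 \<Rightarrow> 0 | Suc m \<Rightarrow> \<sigma> (coeff q m)) + \<delta> (coeff q n)"
  by (simp add: skew_X_def coeff_pCons coeff_map_poly s_0 d_0 split: nat.splits)

private lemma X_add: "Xm (p + q) = Xm p + Xm q"
  by (rule poly_eqI) (simp add: cX s_add d_add split: nat.splits)

private lemma X_0: "Xm 0 = 0"
  using X_add[of 0 0] by simp

private lemma X_L: "Xm (L a q) = L (\<sigma> a) (Xm q) + L (\<delta> a) q"
  by (rule poly_eqI) (simp add: cX cL s_mult d_mult algebra_simps s_0 split: nat.splits)

private lemma L_add: "L a (p + q) = L a p + L a q" and L_add_left: "L (a + b) p = L a p + L b p"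
  and L_L: "L a (L b p) = L (a * b) p" and L_1: "L 1 p = p" and L_0: "L 0 p = 0"
  by (rule poly_eqI; simp add: cL algebra_simps)+

private lemma X_pow_add: "(Xm ^^ i) (p + q) = (Xm ^^ i) p + (Xm ^^ i) q"
  by (induction i) (simp_all add: X_add)

private lemma X_sum: "finite I \<Longrightarrow> Xm (sum h I) = (\<Sum>i\<in>I. Xm (h i))"
  by (induction I rule: finite_induct) (simp_all add: X_add X_0)

private lemma L_sum: "finite I \<Longrightarrow> L a (sum h I) = (\<Sum>i\<in>I. L a (h i))"
  by (induction I rule: finite_induct) (simp_all add: L_add)

private lemma M_bound: "degree p \<le> N \<Longrightarrow> M p q = (\<Sum>i\<le>N. L (coeff p i) ((Xm ^^ i) q))"
  unfolding skew_mult_def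
  by (rule sum.mono_neutral_left) (auto simp: coeff_eq_0 L_0)

private lemma M_add_right: "M p (q + r) = M p q + M p r"
  by (simp add: skew_mult_def X_pow_add L_add sum.distrib)

private lemma M_add_left: "M (p + q) r = M p r + M q r"
proof -
  let ?N = "max (degree p) (degree q)"
  have "degree (p + q) \<le> ?N" by (rule degree_add_le_max)
  then show ?thesis
    by (simp add: M_bound[of _ ?N] L_add_left sum.distrib)
qed

private lemma M_0_left: "M 0 r = 0"
  by (simp add: skew_mult_def L_0)

private lemma M_sum: "finite I \<Longrightarrow> M (sum h I) r = (\<Sum>i\<in>I. M (h i) r)"
  by (induction I rule: finite_induct) (simp_all add: M_add_left M_0_left)

private lemma M_monom: "M (monom a i) q = L a ((Xm ^^ i) q)"
proof -
  have "M (monom a i) q = (\<Sum>k\<le>i. L (coeff (monom a i) k) ((Xm ^^ k) q))"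
    by (rule M_bound) (rule degree_monom_le)
  also have "\<dots> = (\<Sum>k\<le>i. if k = i then L a ((Xm ^^ i) q) else 0)"
    by (rule sum.cong) (auto simp: L_0)
  finally show ?thesis by simp
qed

private lemma M_L: "M (L a p) q = L a (M p q)"
proof -
  have "degree (L a p) \<le> degree p"
    by (rule degree_le) (simp add: cL coeff_eq_0)
  then show ?thesis
    by (simp add: M_bound[of _ "degree p"] L_sum cL L_L)
qed

private lemma X_monom: "Xm (monom a i) = monom (\<sigma> a) (Suc i) + monom (\<delta> a) i"
  by (rule poly_eqI) (auto simp: cX s_0 d_0 split: nat.splits)

private lemma M_X: "M (Xm p) q = Xm (M p q)"
proof -
  have "Xm p = (\<Sum>i\<le>degree p. Xm (monom (coeff p i) i))"
    by (subst (1) poly_as_sum_of_monoms[of p, symmetric]) (simp add: X_sum)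
  then have "M (Xm p) q = (\<Sum>i\<le>degree p. M (Xm (monom (coeff p i) i)) q)"
    by (simp add: M_sum)
  also have "\<dots> = (\<Sum>i\<le>degree p. Xm (L (coeff p i) ((Xm ^^ i) q)))"
    by (simp add: X_monom M_add_left M_monom X_L)
  also have "\<dots> = Xm (M p q)"
    by (simp add: skew_mult_def X_sum)
  finally show ?thesis .
qed

private lemma M_X_pow: "M ((Xm ^^ i) p) q = (Xm ^^ i) (M p q)"
  by (induction i) (simp_all add: M_X)

private lemma M_assoc: "M (M p q) r = M p (M q r)"
proof -
  have "M (M p q) r = (\<Sum>i\<le>degree p. M (L (coeff p i) ((Xm ^^ i) q)) r)"
    by (simp add: M_sum skew_mult_def[of _ _ p])
  also have "\<dots> = M p (M q r)"
    by (simp add: M_L M_X_pow skew_mult_def[of _ _ p])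
  finally show ?thesis .
qed

private lemma X_pow_1: "(Xm ^^ i) [:1:] = monom 1 i"
  by (induction i) (simp_all add: X_monom s_1 d_1 monom_0)

private lemma M_1_right: "M p [:1:] = p"
proof -
  have "M p [:1:] = (\<Sum>i\<le>degree p. monom (coeff p i) i)"
    unfolding skew_mult_def X_pow_1
    by (rule sum.cong) (auto intro!: poly_eqI simp: cL)
  then show ?thesis by (simp add: poly_as_sum_of_monoms)
qed

private lemma M_1_left: "M [:1:] p = p"
  using M_monom[of 1 0 p] by (simp add: monom_0 L_1)

lemma skew_poly_ring_is_ring: "ring (skew_poly_ring \<sigma> \<delta>)"
proof (rule ringI)
  show "abelian_group (skew_poly_ring \<sigma> \<delta>)"
    by (rule abelian_groupI) (auto simp: algebra_simps intro: exI[of _ "- x" for x])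
  show "Group.monoid (skew_poly_ring \<sigma> \<delta>)"
    by (rule monoidI) (auto simp: M_assoc M_1_left M_1_right)
qed (auto simp: M_add_left M_add_right)

lemma skew_mult_monom_1_const: "skew_mult \<sigma> \<delta> (monom 1 1) [:a:] = monom (\<sigma> a) 1 + [:\<delta> a:]"
  using X_monom[of a 0] by (simp add: M_monom L_1 monom_0)

lemma skew_mult_const_monom: "skew_mult \<sigma> \<delta> [:a:] (monom b i) = monom (a * b) i"
  using M_monom[of a 0 "monom b i"] by (auto simp: monom_0 cL intro!: poly_eqI)

end

section \<open>Left ideals, quotients and their submodules\<close>

definition left_ideal :: "('a, 'b) ring_scheme \<Rightarrow> 'a set \<Rightarrow> bool" where
  "left_ideal R I \<longleftrightarrow> subgroup I (add_monoid R) \<and> (\<forall>p\<in>carrier R. \<forall>q\<in>I. p \<otimes>\<^bsub>R\<^esub> q \<in> I)"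

definition left_ideal_gen :: "('a, 'b) ring_scheme \<Rightarrow> 'a \<Rightarrow> 'a set" where
  "left_ideal_gen R p = \<Inter>{I. left_ideal R I \<and> p \<in> I}"

lemma (in ring) left_ideal_gen_eq_cgenideal:
  assumes p: "p \<in> carrier R"
  shows "left_ideal_gen R p = PIdl p"
proof -
  have "subgroup (PIdl p) (add_monoid R)"
  proof (rule add.subgroupI)
    show "PIdl p \<subseteq> carrier R" "PIdl p \<noteq> {}" using p by (auto simp: cgenideal_def)
    fix a assume "a \<in> PIdl p"
    then obtain x where x: "x \<in> carrier R" "a = x \<otimes> p" by (auto simp: cgenideal_def)
    have "\<ominus> a = (\<ominus> x) \<otimes> p" using x p by (simp add: l_minus)
    then show "\<ominus> a \<in> PIdl p" using x by (auto simp: cgenideal_def)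
    fix b assume "b \<in> PIdl p"
    then obtain y where y: "y \<in> carrier R" "b = y \<otimes> p" by (auto simp: cgenideal_def)
    have "a \<oplus> b = (x \<oplus> y) \<otimes> p" using x y p by (simp add: l_distr)
    then show "a \<oplus> b \<in> PIdl p" using x y by (auto simp: cgenideal_def)
  qed
  moreover have "q \<otimes> a \<in> PIdl p" if q: "q \<in> carrier R" and a: "a \<in> PIdl p" for q a
  proof -
    obtain x where x: "x \<in> carrier R" "a = x \<otimes> p" using a by (auto simp: cgenideal_def)
    have "q \<otimes> a = (q \<otimes> x) \<otimes> p" using x p q by (simp add: m_assoc)
    then show ?thesis using x q by (auto simp: cgenideal_def)
  qed
  ultimately have "left_ideal R (PIdl p)" by (simp add: left_ideal_def)
  moreover have "p \<in> PIdl p" using p by (rule cgenideal_self)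
  ultimately have "left_ideal_gen R p \<subseteq> PIdl p" unfolding left_ideal_gen_def by blast
  moreover have "PIdl p \<subseteq> left_ideal_gen R p"
    by (auto simp: left_ideal_gen_def left_ideal_def cgenideal_def)
  ultimately show ?thesis by blast
qed

text \<open>For a left ideal $I$ the quotient $R/I$ is the set \<^term>\<open>a_rcosets\<^bsub>R\<^esub> I\<close> of cosets with the
  addition of \<^term>\<open>R A_Mod I\<close>, and $p\cdot(q+I) = pq+I$.\<close>

definition left_quot_submodule :: "('a, 'b) ring_scheme \<Rightarrow> 'a set \<Rightarrow> 'a set set \<Rightarrow> bool" where
  "left_quot_submodule R I M \<longleftrightarrow>
     subgroup M (R A_Mod I) \<and>
     (\<forall>p\<in>carrier R. \<forall>q\<in>carrier R. I +>\<^bsub>R\<^esub> q \<in> M \<longrightarrow> I +>\<^bsub>R\<^esub> (p \<otimes>\<^bsub>R\<^esub> q) \<in> M)"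

definition right_divisor :: "('a, 'b) ring_scheme \<Rightarrow> 'a \<Rightarrow> 'a \<Rightarrow> bool" where
  "right_divisor R g f \<longleftrightarrow> (\<exists>h\<in>carrier R. f = h \<otimes>\<^bsub>R\<^esub> g)"

section \<open>Companion matrix, pseudo-linear map, codes\<close>

definition companion :: "'a::ring_1 poly \<Rightarrow> 'a mat" where
  "companion f = mat (degree f) (degree f)
     (\<lambda>(i, j). if i = degree f - 1 then - coeff f j else if j = i + 1 then 1 else 0)"

definition vec_times_mat :: "'a::ring_1 vec \<Rightarrow> 'a mat \<Rightarrow> 'a vec" where
  "vec_times_mat x M = vec (dim_col M) (\<lambda>j. x \<bullet> col M j)"

definition pseudo_linear :: "('a::ring_1 \<Rightarrow> 'a) \<Rightarrow> ('a \<Rightarrow> 'a) \<Rightarrow> 'a poly \<Rightarrow> 'a vec \<Rightarrow> 'a vec" where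
  "pseudo_linear \<sigma> \<delta> f x = vec_times_mat (map_vec \<sigma> x) (companion f) + map_vec \<delta> x"

text \<open>The entry $x_j^{(k)}$ of $T_f^k(x)$.\<close>

definition iter_entry ::
    "('a::ring_1 \<Rightarrow> 'a) \<Rightarrow> ('a \<Rightarrow> 'a) \<Rightarrow> 'a poly \<Rightarrow> 'a vec \<Rightarrow> nat \<Rightarrow> nat \<Rightarrow> 'a" where
  "iter_entry \<sigma> \<delta> f x k j = (pseudo_linear \<sigma> \<delta> f ^^ k) x $ j"

text \<open>The vector $(g_0,\dots,g_r,0,\dots,0)\in A^n$.\<close>

definition padded_coeffs :: "nat \<Rightarrow> 'a::zero poly \<Rightarrow> 'a vec" where
  "padded_coeffs n g = vec n (\<lambda>j. if j \<le> degree g then coeff g j else 0)"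

definition code_phi :: "('a::ring_1 \<Rightarrow> 'a) \<Rightarrow> ('a \<Rightarrow> 'a) \<Rightarrow> 'a poly \<Rightarrow> 'a vec \<Rightarrow> 'a poly set" where
  "code_phi \<sigma> \<delta> f d =
     left_ideal_gen (skew_poly_ring \<sigma> \<delta>) f +>\<^bsub>skew_poly_ring \<sigma> \<delta>\<^esub> (\<Sum>i<degree f. monom (d $ i) i)"

definition skew_code_of ::
    "('a::ring_1 \<Rightarrow> 'a) \<Rightarrow> ('a \<Rightarrow> 'a) \<Rightarrow> 'a poly \<Rightarrow> 'a poly set set \<Rightarrow> 'a vec set \<Rightarrow> bool" where
  "skew_code_of \<sigma> \<delta> f M C \<longleftrightarrow>
     left_quot_submodule (skew_poly_ring \<sigma> \<delta>) (left_ideal_gen (skew_poly_ring \<sigma> \<delta>) f) M \<and>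
     C = {d \<in> carrier_vec (degree f). code_phi \<sigma> \<delta> f d \<in> M}"

text \<open>$(g)_l/(f)_l$ is the set of cosets $q+(f)_l$ with $q\in(g)_l$.\<close>

definition principal_skew_code ::
    "('a::ring_1 \<Rightarrow> 'a) \<Rightarrow> ('a \<Rightarrow> 'a) \<Rightarrow> 'a poly \<Rightarrow> 'a poly \<Rightarrow> 'a vec set \<Rightarrow> bool" where
  "principal_skew_code \<sigma> \<delta> f g C \<longleftrightarrow>
     right_divisor (skew_poly_ring \<sigma> \<delta>) g f \<and>
     (\<exists>M. skew_code_of \<sigma> \<delta> f M C \<and>
        M = (\<lambda>q. left_ideal_gen (skew_poly_ring \<sigma> \<delta>) f +>\<^bsub>skew_poly_ring \<sigma> \<delta>\<^esub> q) `
              left_ideal_gen (skew_poly_ring \<sigma> \<delta>) g)"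

section \<open>Bases and generating matrices\<close>

definition left_lincomb :: "nat \<Rightarrow> 'a::ring_1 vec list \<Rightarrow> (nat \<Rightarrow> 'a) \<Rightarrow> 'a vec" where
  "left_lincomb n vs c = finsum_vec TYPE('a) n (\<lambda>i. c i \<cdot>\<^sub>v vs ! i) {..<length vs}"

definition left_basis :: "nat \<Rightarrow> 'a::ring_1 vec list \<Rightarrow> 'a vec set \<Rightarrow> bool" where
  "left_basis n vs C \<longleftrightarrow>
     set vs \<subseteq> carrier_vec n \<and>
     (\<forall>c. left_lincomb n vs c = 0\<^sub>v n \<longrightarrow> (\<forall>i<length vs. c i = 0)) \<and>
     C = range (left_lincomb n vs)"

definition left_free_of_rank :: "nat \<Rightarrow> 'a::ring_1 vec set \<Rightarrow> nat \<Rightarrow> bool" where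
  "left_free_of_rank n C m \<longleftrightarrow> (\<exists>vs. length vs = m \<and> left_basis n vs C)"

definition generating_matrix :: "nat \<Rightarrow> nat \<Rightarrow> 'a::ring_1 mat \<Rightarrow> 'a vec set \<Rightarrow> bool" where
  "generating_matrix m n G C \<longleftrightarrow>
     left_free_of_rank n C m \<and> G \<in> carrier_mat m n \<and> left_basis n (rows G) C"

end

theory Submission
  imports Defs
begin

text \<open>
  Write \<open>p\<close> for a skew polynomial of degree less than \<open>n\<close> and also for its coefficient vector in
  \<open>A\<^sup>n\<close>, which is \<^term>\<open>padded_coeffs n p\<close>. The map \<open>T\<^sub>f\<close> is left multiplication by \<open>X\<close> modulo \<open>f\<close>,
  and as long as \<open>X p\<close> still has degree less than \<open>n\<close> no reduction takes place: the last row
  of the companion matrix is multiplied by \<open>\<sigma> 0 = 0\<close>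
  (\<open>pseudo_linear_padded_coeffs\<close>). Since \<open>g\<close> is monic of degree \<open>r\<close> and \<open>\<sigma> 1 = 1\<close>, the polynomial
  \<open>X\<^sup>i g\<close> is monic of degree \<open>r + i\<close>. Hence for \<open>i < n - r\<close> the \<open>i\<close>-th row of the matrix is the
  coefficient vector of \<open>X\<^sup>i g\<close> (\<open>funpow_pseudo_linear_padded_coeffs\<close>), and the recursions for its
  entries are the formula for the coefficients of \<open>X p\<close>.

  On the other side, \<open>(f)\<^sub>l \<subseteq> (g)\<^sub>l\<close> because \<open>g\<close> divides \<open>f\<close> on the right, so the code consists of
  the coefficient vectors of the left multiples \<open>q g\<close> of degree less than \<open>n\<close>
  (\<open>principal_skew_code_iff\<close>). As \<open>g\<close> is monic, the degree of \<open>q g\<close> is \<open>deg q + r\<close>, even over a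
  ring with zero divisors (\<open>degree_skew_mult_monic\<close>). These multiples therefore are the sums
  \<open>\<Sum>\<^sub>i c\<^sub>i X\<^sup>i g\<close> over \<open>i < n - r\<close>, with
  \<open>q = \<Sum>\<^sub>i c\<^sub>i X\<^sup>i\<close>, and such a sum vanishes only if \<open>q = 0\<close>. This is the statement that the rows
  form a basis (\<open>left_basis_skew_X_powers\<close>).
\<close>

lemma coeff_sum_monom_lessThan:
  "coeff (\<Sum>i<m. monom (c i) i) k = (if k < m then c k else (0::'a::comm_monoid_add))"
  by (simp add: coeff_sum)

lemma padded_coeffs_eq_vec_coeff: "padded_coeffs n p = vec n (coeff p)"
  by (auto simp: padded_coeffs_def coeff_eq_0)

lemma padded_coeffs_sum_monom:
  assumes "d \<in> carrier_vec n"
  shows "padded_coeffs n (\<Sum>i<n. monom (d $ i) i) = d"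
  using assms by (auto simp: padded_coeffs_eq_vec_coeff coeff_sum_monom_lessThan)

lemma sum_monom_padded_coeffs:
  assumes "\<And>k. n \<le> k \<Longrightarrow> coeff p k = 0"
  shows "(\<Sum>i<n. monom (padded_coeffs n p $ i) i) = p"
  using assms
  by (intro poly_eqI) (auto simp: padded_coeffs_eq_vec_coeff coeff_sum_monom_lessThan)

context
  fixes \<sigma> \<delta> :: "'a::ring_1 \<Rightarrow> 'a"
  assumes endo: "ring_endo \<sigma>" and deriv: "skew_derivation \<sigma> \<delta>"
begin

section \<open>Degrees of left multiples\<close>

lemma ring_endo_zero: "\<sigma> 0 = 0"
proof -
  have "\<sigma> (0 + 0) = \<sigma> 0 + \<sigma> 0" using endo unfolding ring_endo_def by blast
  then show ?thesis by simp
qed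

lemma skew_derivation_zero: "\<delta> 0 = 0"
proof -
  have "\<delta> (0 + 0) = \<delta> 0 + \<delta> 0" using deriv unfolding skew_derivation_def by blast
  then show ?thesis by simp
qed

lemma ring_endo_funpow_one: "(\<sigma> ^^ i) 1 = 1"
  using endo by (induction i) (simp_all add: ring_endo_def)

lemma coeff_skew_X:
  "coeff (skew_X \<sigma> \<delta> p) k = (case k of 0 \<Rightarrow> 0 | Suc m \<Rightarrow> \<sigma> (coeff p m)) + \<delta> (coeff p k)"
  by (simp add: skew_X_def coeff_pCons coeff_map_poly ring_endo_zero skew_derivation_zero
      split: nat.splits)

lemma coeff_skew_X_funpow_above:
  assumes "degree g + i < k"
  shows "coeff ((skew_X \<sigma> \<delta> ^^ i) g) k = 0"
  using assms
  by (induction i arbitrary: k)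
     (auto simp: coeff_skew_X coeff_eq_0 ring_endo_zero skew_derivation_zero split: nat.splits)

lemma coeff_skew_X_funpow_top:
  "coeff ((skew_X \<sigma> \<delta> ^^ i) g) (degree g + i) = (\<sigma> ^^ i) (lead_coeff g)"
  by (induction i) (simp_all add: coeff_skew_X coeff_skew_X_funpow_above skew_derivation_zero)

lemma coeff_skew_mult:
  assumes "\<And>i. m \<le> i \<Longrightarrow> coeff p i = 0"
  shows "coeff (skew_mult \<sigma> \<delta> p q) k = (\<Sum>i<m. coeff p i * coeff ((skew_X \<sigma> \<delta> ^^ i) q) k)"
proof -
  have "coeff (skew_mult \<sigma> \<delta> p q) k
      = (\<Sum>i\<le>degree p. coeff p i * coeff ((skew_X \<sigma> \<delta> ^^ i) q) k)"
    by (simp add: skew_mult_def coeff_sum coeff_map_poly)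
  also have "\<dots> = (\<Sum>i<m. coeff p i * coeff ((skew_X \<sigma> \<delta> ^^ i) q) k)"
  proof (rule sum.mono_neutral_cong)
    show "coeff p i * coeff ((skew_X \<sigma> \<delta> ^^ i) q) k = 0" if "i \<in> {..<m} - {..degree p}" for i
      using that by (simp add: coeff_eq_0)
    show "coeff p i * coeff ((skew_X \<sigma> \<delta> ^^ i) q) k = 0" if "i \<in> {..degree p} - {..<m}" for i
      using that assms by simp
  qed simp_all
  finally show ?thesis .
qed

lemma coeff_skew_mult_above:
  assumes "degree p + degree g < k"
  shows "coeff (skew_mult \<sigma> \<delta> p g) k = 0"
  using assms
  by (simp add: coeff_skew_mult[of "Suc (degree p)"] coeff_eq_0 coeff_skew_X_funpow_above)

text \<open>Only \<open>X\<^sup>i g\<close> with \<open>i = degree p\<close> reaches this degree, and its top coefficient is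
  \<open>(\<sigma> ^^ i) 1 = 1\<close>; so nothing can cancel even if \<open>A\<close> has zero divisors or \<open>\<sigma>\<close> is not
  injective.\<close>

lemma coeff_skew_mult_top:
  assumes "lead_coeff g = 1"
  shows "coeff (skew_mult \<sigma> \<delta> p g) (degree p + degree g) = lead_coeff p"
proof -
  have "coeff ((skew_X \<sigma> \<delta> ^^ degree p) g) (degree p + degree g) = 1"
    using coeff_skew_X_funpow_top[of "degree p" g] assms
    by (simp add: ring_endo_funpow_one add.commute)
  then show ?thesis
    by (simp add: coeff_skew_mult[of "Suc (degree p)"] coeff_eq_0 coeff_skew_X_funpow_above)
qed

lemma degree_skew_mult_monic:
  assumes "lead_coeff g = 1" "p \<noteq> 0"
  shows "degree (skew_mult \<sigma> \<delta> p g) = degree p + degree g"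
proof (rule antisym)
  show "degree (skew_mult \<sigma> \<delta> p g) \<le> degree p + degree g"
    by (rule degree_le) (simp add: coeff_skew_mult_above)
  show "degree p + degree g \<le> degree (skew_mult \<sigma> \<delta> p g)"
    using assms by (intro le_degree) (simp add: coeff_skew_mult_top)
qed

lemma skew_mult_monic_eq_0:
  assumes "lead_coeff g = 1" "skew_mult \<sigma> \<delta> p g = 0"
  shows "p = 0"
  using coeff_skew_mult_top[OF assms(1), of p] assms(2) by simp

section \<open>The pseudo-linear map as multiplication by \<open>X\<close>\<close>

text \<open>The bound on the degree says that \<open>X p\<close> needs no reduction modulo \<open>f\<close>.\<close>

lemma pseudo_linear_padded_coeffs:
  assumes "degree p + 1 < degree f"
  shows "pseudo_linear \<sigma> \<delta> f (padded_coeffs (degree f) p) = padded_coeffs (degree f) (skew_X \<sigma> \<delta> p)"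
proof (rule eq_vecI)
  let ?n = "degree f"
  fix j assume "j < dim_vec (padded_coeffs ?n (skew_X \<sigma> \<delta> p))"
  then have j: "j < ?n" by (simp add: padded_coeffs_def)
  have "map_vec \<sigma> (padded_coeffs ?n p) \<bullet> col (companion f) j
      = (\<Sum>i<?n. \<sigma> (coeff p i) * (if i = ?n - 1 then - coeff f j else if j = i + 1 then 1 else 0))"
    using j
    by (simp add: scalar_prod_def companion_def padded_coeffs_eq_vec_coeff atLeast0LessThan)
  also have "\<dots> = (\<Sum>i<?n. if j = i + 1 then \<sigma> (coeff p i) else 0)"
    \<comment> \<open>The last row of the companion matrix meets a zero coefficient of \<open>p\<close>.\<close>
    using assms j by (intro sum.cong) (auto simp: coeff_eq_0 ring_endo_zero)
  also have "\<dots> = (case j of 0 \<Rightarrow> 0 | Suc m \<Rightarrow> \<sigma> (coeff p m))"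
    using j by (cases j) simp_all
  finally show "pseudo_linear \<sigma> \<delta> f (padded_coeffs ?n p) $ j
      = padded_coeffs ?n (skew_X \<sigma> \<delta> p) $ j"
    using j by (simp add: pseudo_linear_def vec_times_mat_def companion_def
        padded_coeffs_eq_vec_coeff coeff_skew_X)
qed (simp add: pseudo_linear_def padded_coeffs_def)

lemma funpow_pseudo_linear_padded_coeffs:
  assumes "degree g + i < degree f"
  shows "(pseudo_linear \<sigma> \<delta> f ^^ i) (padded_coeffs (degree f) g)
      = padded_coeffs (degree f) ((skew_X \<sigma> \<delta> ^^ i) g)"
  using assms
proof (induction i)
  case (Suc i)
  have "degree ((skew_X \<sigma> \<delta> ^^ i) g) \<le> degree g + i"
    by (rule degree_le) (simp add: coeff_skew_X_funpow_above)
  with Suc show ?case by (simp add: pseudo_linear_padded_coeffs)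
qed simp

lemma iter_entry_padded_coeffs:
  assumes "degree g + i < degree f" "j < degree f"
  shows "iter_entry \<sigma> \<delta> f (padded_coeffs (degree f) g) i j = coeff ((skew_X \<sigma> \<delta> ^^ i) g) j"
  using assms
  unfolding iter_entry_def funpow_pseudo_linear_padded_coeffs[OF assms(1)]
  by (simp add: padded_coeffs_eq_vec_coeff)

section \<open>The code as a set of left multiples\<close>

lemma left_ideal_gen_skew_poly_ring:
  "left_ideal_gen (skew_poly_ring \<sigma> \<delta>) p = range (\<lambda>q. skew_mult \<sigma> \<delta> q p)"
  using ring.left_ideal_gen_eq_cgenideal[OF skew_poly_ring_is_ring[OF endo deriv], of p]
  by (auto simp: cgenideal_def)

text \<open>If \<open>p + (f)\<^sub>l = q + (f)\<^sub>l\<close> with \<open>q \<in> (g)\<^sub>l\<close>, then \<open>p \<in> (f)\<^sub>l + (g)\<^sub>l = (g)\<^sub>l\<close>.\<close>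

lemma principal_skew_code_iff:
  assumes "principal_skew_code \<sigma> \<delta> f g C"
  shows "d \<in> C \<longleftrightarrow> d \<in> carrier_vec (degree f) \<and>
    (\<exists>q. (\<Sum>i<degree f. monom (d $ i) i) = skew_mult \<sigma> \<delta> q g)"
proof -
  let ?R = "skew_poly_ring \<sigma> \<delta>"
  let ?I = "left_ideal_gen ?R f" and ?J = "left_ideal_gen ?R g"
  interpret R: ring ?R by (rule skew_poly_ring_is_ring[OF endo deriv])
  obtain h where h: "f = skew_mult \<sigma> \<delta> h g"
    using assms by (auto simp: principal_skew_code_def right_divisor_def)
  have coset: "?I +>\<^bsub>?R\<^esub> p = (\<lambda>u. u + p) ` ?I" for p
    by (auto simp: a_r_coset_def')
  have I_0: "0 \<in> ?I"
    using R.l_null[of f] by (auto simp: left_ideal_gen_skew_poly_ring intro: range_eqI[of _ _ 0])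
  have J_add: "u + v \<in> ?J" if uv: "u \<in> ?I" "v \<in> ?J" for u v
  proof -
    obtain x y where "u = skew_mult \<sigma> \<delta> x f" "v = skew_mult \<sigma> \<delta> y g"
      using uv unfolding left_ideal_gen_skew_poly_ring by blast
    then have "u + v = skew_mult \<sigma> \<delta> (skew_mult \<sigma> \<delta> x h + y) g"
      using R.m_assoc[of x h g] R.l_distr[of "skew_mult \<sigma> \<delta> x h" y g] h by simp
    then show ?thesis by (auto simp: left_ideal_gen_skew_poly_ring)
  qed
  have "?I +>\<^bsub>?R\<^esub> p \<in> (\<lambda>q. ?I +>\<^bsub>?R\<^esub> q) ` ?J \<longleftrightarrow> p \<in> ?J" for p
  proof
    assume "?I +>\<^bsub>?R\<^esub> p \<in> (\<lambda>q. ?I +>\<^bsub>?R\<^esub> q) ` ?J"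
    then obtain q where q: "q \<in> ?J" "?I +>\<^bsub>?R\<^esub> p = ?I +>\<^bsub>?R\<^esub> q" by blast
    have "p \<in> ?I +>\<^bsub>?R\<^esub> p" using I_0 unfolding coset by (intro image_eqI[of _ _ 0]) simp_all
    then show "p \<in> ?J" using q J_add unfolding coset by auto
  qed simp
  moreover have "C = {d \<in> carrier_vec (degree f).
      code_phi \<sigma> \<delta> f d \<in> (\<lambda>q. ?I +>\<^bsub>?R\<^esub> q) ` ?J}"
    using assms by (auto simp: principal_skew_code_def skew_code_of_def)
  ultimately show ?thesis
    by (simp add: code_phi_def) (auto simp: left_ideal_gen_skew_poly_ring)
qed

lemma principal_skew_code_degree_le:
  assumes "principal_skew_code \<sigma> \<delta> f g C" "lead_coeff g = 1" "f \<noteq> 0"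
  shows "degree g \<le> degree f"
proof -
  obtain h where h: "f = skew_mult \<sigma> \<delta> h g"
    using assms(1) by (auto simp: principal_skew_code_def right_divisor_def)
  have "h \<noteq> 0"
  proof
    assume "h = 0"
    then have "f = 0"
      unfolding h by (intro poly_eqI) (simp add: coeff_skew_mult[of 0])
    then show False using assms(3) by simp
  qed
  then show ?thesis using h degree_skew_mult_monic[OF assms(2)] by simp
qed

section \<open>The basis of the code\<close>

lemma left_lincomb_skew_X_powers:
  "left_lincomb n (map (\<lambda>i. padded_coeffs n ((skew_X \<sigma> \<delta> ^^ i) g)) [0..<m]) c
    = padded_coeffs n (skew_mult \<sigma> \<delta> (\<Sum>i<m. monom (c i) i) g)"
proof (rule eq_vecI)
  let ?v = "\<lambda>i. c i \<cdot>\<^sub>v map (\<lambda>i. padded_coeffs n ((skew_X \<sigma> \<delta> ^^ i) g)) [0..<m] ! i"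
  have v: "?v \<in> {..<m} \<rightarrow> carrier_vec n"
    by (auto simp: padded_coeffs_eq_vec_coeff)
  have "finsum_vec TYPE('a) n ?v {..<m} \<in> carrier_vec n"
    using v by (rule finsum_vec_closed)
  then show "dim_vec (left_lincomb n (map (\<lambda>i. padded_coeffs n ((skew_X \<sigma> \<delta> ^^ i) g)) [0..<m]) c)
      = dim_vec (padded_coeffs n (skew_mult \<sigma> \<delta> (\<Sum>i<m. monom (c i) i) g))"
    by (simp add: left_lincomb_def padded_coeffs_def)
  fix k assume "k < dim_vec (padded_coeffs n (skew_mult \<sigma> \<delta> (\<Sum>i<m. monom (c i) i) g))"
  then have k: "k < n" by (simp add: padded_coeffs_def)
  have "finsum_vec TYPE('a) n ?v {..<m} $ k = (\<Sum>i<m. ?v i $ k)"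
    using k v by (intro index_finsum_vec) simp_all
  also have "\<dots> = (\<Sum>i<m. c i * coeff ((skew_X \<sigma> \<delta> ^^ i) g) k)"
    using k by (intro sum.cong) (simp_all add: padded_coeffs_eq_vec_coeff)
  also have "\<dots> = coeff (skew_mult \<sigma> \<delta> (\<Sum>i<m. monom (c i) i) g) k"
    by (simp add: coeff_skew_mult[of m] coeff_sum_monom_lessThan)
  finally show "left_lincomb n (map (\<lambda>i. padded_coeffs n ((skew_X \<sigma> \<delta> ^^ i) g)) [0..<m]) c $ k
      = padded_coeffs n (skew_mult \<sigma> \<delta> (\<Sum>i<m. monom (c i) i) g) $ k"
    using k by (simp add: left_lincomb_def padded_coeffs_eq_vec_coeff)
qed

lemma left_basis_skew_X_powers:
  assumes code: "principal_skew_code \<sigma> \<delta> f g C"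
    and monic: "lead_coeff g = 1" and "f \<noteq> 0"
  shows "left_basis (degree f)
    (map (\<lambda>i. padded_coeffs (degree f) ((skew_X \<sigma> \<delta> ^^ i) g)) [0..<degree f - degree g]) C"
proof -
  let ?n = "degree f" and ?m = "degree f - degree g"
  let ?vs = "map (\<lambda>i. padded_coeffs ?n ((skew_X \<sigma> \<delta> ^^ i) g)) [0..<?m]"
  let ?q = "\<lambda>c. \<Sum>i<?m. monom (c i) i"
  have le: "degree g \<le> ?n"
    using assms by (rule principal_skew_code_degree_le)
  have small: "coeff (skew_mult \<sigma> \<delta> (?q c) g) k = 0" if "?n \<le> k" for c k
    using that le
    by (simp add: coeff_skew_mult[of ?m] coeff_sum_monom_lessThan coeff_skew_X_funpow_above)
  have "c i = 0" if zero: "left_lincomb ?n ?vs c = 0\<^sub>v ?n" and i: "i < ?m" for c i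
  proof -
    have "padded_coeffs ?n (skew_mult \<sigma> \<delta> (?q c) g) = 0\<^sub>v ?n"
      using zero by (simp only: left_lincomb_skew_X_powers)
    then have "skew_mult \<sigma> \<delta> (?q c) g = 0"
      using sum_monom_padded_coeffs[of ?n "skew_mult \<sigma> \<delta> (?q c) g"] small
      by simp
    then have "?q c = 0" by (rule skew_mult_monic_eq_0[OF monic])
    then show ?thesis using coeff_sum_monom_lessThan[of c ?m i] i by simp
  qed
  moreover have "C = range (left_lincomb ?n ?vs)"
  proof (intro equalityI subsetI)
    fix d assume "d \<in> C"
    then obtain q where d: "d \<in> carrier_vec ?n"
      and q: "(\<Sum>i<?n. monom (d $ i) i) = skew_mult \<sigma> \<delta> q g"
      using principal_skew_code_iff[OF code] by blast
    \<comment> \<open>As \<open>q g\<close> has degree less than \<open>n\<close>, the degree of \<open>q\<close> is less than \<open>n - r\<close>.\<close>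
    have "coeff q i = 0" if "?m \<le> i" for i
    proof (cases "q = 0 \<or> degree q < i")
      case False
      then have "coeff (\<Sum>i<?n. monom (d $ i) i) (degree q + degree g) = lead_coeff q"
        using q coeff_skew_mult_top[OF monic, of q] by simp
      then show ?thesis using False that le
        by (simp add: coeff_sum_monom_lessThan split: if_splits)
    qed (auto simp: coeff_eq_0)
    then have "?q (coeff q) = q"
      by (intro poly_eqI) (simp add: coeff_sum_monom_lessThan)
    then have "left_lincomb ?n ?vs (coeff q) = d"
      using padded_coeffs_sum_monom[OF d] q by (simp add: left_lincomb_skew_X_powers)
    then show "d \<in> range (left_lincomb ?n ?vs)" by blast
  next
    fix d assume "d \<in> range (left_lincomb ?n ?vs)"
    then obtain c where "d = padded_coeffs ?n (skew_mult \<sigma> \<delta> (?q c) g)"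
      by (auto simp: left_lincomb_skew_X_powers)
    then show "d \<in> C"
      using sum_monom_padded_coeffs[OF small]
      by (auto simp: principal_skew_code_iff[OF code] padded_coeffs_eq_vec_coeff)
  qed
  ultimately show ?thesis
    by (auto simp: left_basis_def padded_coeffs_eq_vec_coeff)
qed

end

section \<open>The generating matrix\<close>

theorem theorem3p7:
  fixes \<sigma> \<delta> :: "'a::ring_1 \<Rightarrow> 'a" and f g :: "'a poly" and n r :: nat and C :: "'a vec set"
  assumes "invariant_basis_number TYPE('a)"
    and "ring_endo \<sigma>" and "skew_derivation \<sigma> \<delta>"
    and "degree f = n" and "coeff f n = 1"
    and "degree g = r" and "coeff g r = 1"
    and "principal_skew_code \<sigma> \<delta> f g C"
  shows
    "generating_matrix (n - r) n
       (mat (n - r) n (\<lambda>(i, j).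
          if j < r + i then iter_entry \<sigma> \<delta> f (padded_coeffs n g) i j
          else if j = r + i then (\<sigma> ^^ i) (coeff g r)
          else 0)) C
     \<and> (\<forall>i. r + 1 \<le> i \<and> i \<le> n - 1 \<longrightarrow>
          coeff g i = 0 \<and> iter_entry \<sigma> \<delta> f (padded_coeffs n g) 0 i = 0)
     \<and> (\<forall>i. 1 \<le> i \<and> i \<le> n - r - 1 \<longrightarrow>
          iter_entry \<sigma> \<delta> f (padded_coeffs n g) i 0
            = \<delta> (iter_entry \<sigma> \<delta> f (padded_coeffs n g) (i - 1) 0))
     \<and> (\<forall>i j. 1 \<le> i \<and> i \<le> n - r - 1 \<and> 1 \<le> j \<and> j \<le> n - 2 \<longrightarrow>
          iter_entry \<sigma> \<delta> f (padded_coeffs n g) i j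
            = \<delta> (iter_entry \<sigma> \<delta> f (padded_coeffs n g) (i - 1) j)
              + \<sigma> (iter_entry \<sigma> \<delta> f (padded_coeffs n g) (i - 1) (j - 1)))"
proof -
  note endo = assms(2) and deriv = assms(3) and code = assms(8)
  have n: "degree f = n" and r: "degree g = r" and f: "f \<noteq> 0" and g: "lead_coeff g = 1"
    using assms(4-7) by auto
  let ?p = "\<lambda>i. (skew_X \<sigma> \<delta> ^^ i) g"
  let ?G = "mat (n - r) n (\<lambda>(i, j).
          if j < r + i then iter_entry \<sigma> \<delta> f (padded_coeffs n g) i j
          else if j = r + i then (\<sigma> ^^ i) (coeff g r)
          else 0)"
  have entry: "iter_entry \<sigma> \<delta> f (padded_coeffs n g) i j = coeff (?p i) j"
    if "r + i < n" "j < n" for i j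
    using iter_entry_padded_coeffs[OF endo deriv, of g i f j] that n r by simp
  have "rows ?G = map (\<lambda>i. padded_coeffs n (?p i)) [0..<n - r]"
  proof (rule nth_equalityI)
    fix i assume "i < length (rows ?G)"
    then have i: "i < n - r" by simp
    have "row ?G i = padded_coeffs n (?p i)"
    proof (rule eq_vecI)
      fix j assume "j < dim_vec (padded_coeffs n (?p i))"
      then have j: "j < n" by (simp add: padded_coeffs_def)
      \<comment> \<open>On and to the right of the diagonal \<open>j = r + i\<close> the prescribed values are those of the
        monic polynomial \<open>X\<^sup>i g\<close> of degree \<open>r + i\<close>.\<close>
      show "row ?G i $ j = padded_coeffs n (?p i) $ j"
        using i j r entry coeff_skew_X_funpow_top[OF endo deriv, of i g]
          coeff_skew_X_funpow_above[OF endo deriv, of g i j]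
        by (auto simp: padded_coeffs_eq_vec_coeff)
    qed (simp add: padded_coeffs_def)
    then show "rows ?G ! i = map (\<lambda>i. padded_coeffs n (?p i)) [0..<n - r] ! i"
      using i by simp
  qed simp
  then have basis: "left_basis n (rows ?G) C"
    using left_basis_skew_X_powers[OF endo deriv code g f] n r by simp
  then have "generating_matrix (n - r) n ?G C"
    unfolding generating_matrix_def left_free_of_rank_def by (auto intro!: exI[of _ "rows ?G"])
  moreover have "coeff g i = 0 \<and> iter_entry \<sigma> \<delta> f (padded_coeffs n g) 0 i = 0"
    if "r + 1 \<le> i \<and> i \<le> n - 1" for i
    using that r entry[of 0 i] by (auto simp: coeff_eq_0)
  moreover have "iter_entry \<sigma> \<delta> f (padded_coeffs n g) i 0
      = \<delta> (iter_entry \<sigma> \<delta> f (padded_coeffs n g) (i - 1) 0)"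
    if "1 \<le> i \<and> i \<le> n - r - 1" for i
    using that by (cases i) (simp_all add: entry coeff_skew_X[OF endo deriv])
  moreover have "iter_entry \<sigma> \<delta> f (padded_coeffs n g) i j
      = \<delta> (iter_entry \<sigma> \<delta> f (padded_coeffs n g) (i - 1) j)
        + \<sigma> (iter_entry \<sigma> \<delta> f (padded_coeffs n g) (i - 1) (j - 1))"
    if "1 \<le> i \<and> i \<le> n - r - 1 \<and> 1 \<le> j \<and> j \<le> n - 2" for i j
    using that
    by (cases i; cases j) (simp_all add: entry coeff_skew_X[OF endo deriv] add.commute)
  ultimately show ?thesis by blast
qed

end
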